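(* Let $\gamma_n$ be the chromatic number of the $n$-dimensional cyclohedron (with respect to proper colourings of its facets). When $n$ tends to infinity, $\gamma_n\sim n\ln n$, i.e. $\lim_{n\to+\infty}\frac{\gamma_n}{n\ln n}=1$.
   Context: For $n\geq 1$ let $[n]=\{1,\ldots,n\}$ and $[n]_0=\{0,1,\ldots,n\}$. A building set is a collection $\mathcal{B}$ of nonempty subsets of $[n]_0$ containing all singletons $\{x\}$, $x\in[n]_0$, such that $S_1,S_2\in\mathcal{B}$ and $S_1\cap S_2\neq\emptyset$ imply $S_1\cup S_2\in\mathcal{B}$. For a family of sets $N$, an $N$-antichain is a subset $\{X_1,\ldots,X_m\}\subseteq N$ with $m\geq 2$ whose members are mutually incomparable with respect to $\subseteq$. Assuming $[n]_0\in\mathcal{B}$, a set $N\subseteq\mathcal{B}$ is nested when the union of every $N$-antichain is not an element of $\mathcal{B}$. The nested-set complex of $\mathcal{B}$ is the simplicial complex of all nested sets $N$ with $[n]_0\notin N$. It is realised by a simple $n$-dimensional polytope (the nestohedron of $\mathcal{B}$): its face lattice with the bottom (the empty face) removed is isomorphic to the complex ordered by $\supseteq$. Hence its facets are identified with the elements $X\in\mathcal{B}$, $X\neq[n]_0$, and two facets have a common vertex iff some nested set contains both. The $n$-dimensional cyclohedron is the nestohedron of the building set of all nonempty connected subsets of vertices of the cycle $0-1-\cdots-n-0$. Two facets of a polytope are separated when they have no vertex in common. For $\mathcal{F}$ the set of facets of a polytope, a function $f\colon\mathcal{F}\to[m]$ is a proper colouring when every two (distinct) facets of the same colour are separated. The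 chromatic number of the polytope is the minimal $m$ such that a proper colouring of its facets with $m$ colours exists. *)

theory Defs
  imports "HOL-Analysis.Analysis"
begin

section \<open>Proper colourings\<close>

definition proper_colouring ::
    "'f set \<Rightarrow> ('f \<Rightarrow> 'f \<Rightarrow> bool) \<Rightarrow> nat \<Rightarrow> ('f \<Rightarrow> nat) \<Rightarrow> bool" where
  "proper_colouring \<F> sep m f \<longleftrightarrow>
     f \<in> \<F> \<rightarrow> {1..m} \<and>
     (\<forall>X\<in>\<F>. \<forall>Y\<in>\<F>. X \<noteq> Y \<and> f X = f Y \<longrightarrow> sep X Y)"

definition chromatic_number :: "'f set \<Rightarrow> ('f \<Rightarrow> 'f \<Rightarrow> bool) \<Rightarrow> nat" where
  "chromatic_number \<F> sep = (LEAST m. \<exists>f. proper_colouring \<F> sep m f)"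

definition separated_facets :: "'a::euclidean_space set \<Rightarrow> 'a set \<Rightarrow> 'a set \<Rightarrow> bool" where
  "separated_facets P F G \<longleftrightarrow> \<not> (\<exists>v. v extreme_point_of P \<and> v \<in> F \<and> v \<in> G)"

definition polytope_chromatic_number :: "'a::euclidean_space set \<Rightarrow> nat" where
  "polytope_chromatic_number P = chromatic_number {F. F facet_of P} (separated_facets P)"


section \<open>Building sets and nested sets\<close>

definition building_set :: "nat \<Rightarrow> nat set set \<Rightarrow> bool" where
  "building_set n B \<longleftrightarrow>
     (\<forall>S\<in>B. S \<noteq> {} \<and> S \<subseteq> {0..n}) \<and>
     (\<forall>x\<in>{0..n}. {x} \<in> B) \<and>
     (\<forall>S\<in>B. \<forall>T\<in>B. S \<inter> T \<noteq> {} \<longrightarrow> S \<union> T \<in> B)"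

definition antichain_of :: "'a set set \<Rightarrow> 'a set set \<Rightarrow> bool" where
  "antichain_of N A \<longleftrightarrow>
     A \<subseteq> N \<and> finite A \<and> card A \<ge> 2 \<and>
     (\<forall>X\<in>A. \<forall>Y\<in>A. X \<noteq> Y \<longrightarrow> \<not> X \<subseteq> Y \<and> \<not> Y \<subseteq> X)"

definition nested :: "'a set set \<Rightarrow> 'a set set \<Rightarrow> bool" where
  "nested B N \<longleftrightarrow> N \<subseteq> B \<and> (\<forall>A. antichain_of N A \<longrightarrow> \<Union>A \<notin> B)"

definition nested_set_complex :: "nat \<Rightarrow> nat set set \<Rightarrow> nat set set set" where
  "nested_set_complex n B = {N. nested B N \<and> {0..n} \<notin> N}"


section \<open>Nestohedra\<close>

text \<open>
  A nestohedron is given only up to combinatorial equivalence, by its face lattice: the nonempty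
  faces are the members of the nested-set complex, ordered by reverse inclusion.  Thus the
  facets are the singletons \<open>{X}\<close>, identified with \<open>X\<close>; the vertices, which are the
  minimal nonempty faces, are the maximal nested sets; and a vertex \<open>N\<close> lies on the facet \<open>X\<close>
  iff \<open>X \<in> N\<close>.
\<close>

definition nestohedron_facets :: "nat \<Rightarrow> nat set set \<Rightarrow> nat set set" where
  "nestohedron_facets n B = B - {{0..n}}"

definition nestohedron_vertices :: "nat \<Rightarrow> nat set set \<Rightarrow> nat set set set" where
  "nestohedron_vertices n B =
     {N \<in> nested_set_complex n B. \<forall>M \<in> nested_set_complex n B. N \<subseteq> M \<longrightarrow> M = N}"

definition nestohedron_separated :: "nat \<Rightarrow> nat set set \<Rightarrow> nat set \<Rightarrow> nat set \<Rightarrow> bool" where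
  "nestohedron_separated n B X Y \<longleftrightarrow>
     \<not> (\<exists>v \<in> nestohedron_vertices n B. X \<in> v \<and> Y \<in> v)"

definition nestohedron_chromatic_number :: "nat \<Rightarrow> nat set set \<Rightarrow> nat" where
  "nestohedron_chromatic_number n B =
     chromatic_number (nestohedron_facets n B) (nestohedron_separated n B)"


section \<open>Cyclohedra\<close>

text \<open>The edges, in both directions, of the cycle \<open>0 - 1 - \<dots> - n - 0\<close>.\<close>

definition cycle_edges :: "nat \<Rightarrow> nat rel" where
  "cycle_edges n = (let E = {(i, Suc i) | i. i < n} \<union> {(n, 0)} in E \<union> E\<inverse>)"

definition connected_in :: "'a rel \<Rightarrow> 'a set \<Rightarrow> bool" where
  "connected_in E S \<longleftrightarrow> (\<forall>x\<in>S. \<forall>y\<in>S. (x, y) \<in> (Restr E S)\<^sup>*)"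

definition cyclohedron_building_set :: "nat \<Rightarrow> nat set set" where
  "cyclohedron_building_set n =
     {S. S \<noteq> {} \<and> S \<subseteq> {0..n} \<and> connected_in (cycle_edges n) S}"

definition cyclohedron_chromatic_number :: "nat \<Rightarrow> nat" where
  "cyclohedron_chromatic_number n =
     nestohedron_chromatic_number n (cyclohedron_building_set n)"

lemma connected_in_Un:
  assumes "connected_in E S" "connected_in E T" "S \<inter> T \<noteq> {}"
  shows "connected_in E (S \<union> T)"
proof -
  obtain z where z: "z \<in> S" "z \<in> T" using assms(3) by blast
  have mS: "(Restr E S)\<^sup>* \<subseteq> (Restr E (S \<union> T))\<^sup>*" by (rule rtrancl_mono) blast
  have mT: "(Restr E T)\<^sup>* \<subseteq> (Restr E (S \<union> T))\<^sup>*" by (rule rtrancl_mono) blast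
  have to: "(x, z) \<in> (Restr E (S \<union> T))\<^sup>*" and fro: "(z, x) \<in> (Restr E (S \<union> T))\<^sup>*"
    if "x \<in> S \<union> T" for x
    using that assms(1,2) z mS mT unfolding connected_in_def by blast+
  show ?thesis
    unfolding connected_in_def using to fro by (meson rtrancl_trans)
qed

lemma top_in_cyclohedron_building_set: "{0..n} \<in> cyclohedron_building_set n"
proof -
  let ?R = "Restr (cycle_edges n) {0..n}"
  have "(0, k) \<in> ?R\<^sup>* \<and> (k, 0) \<in> ?R\<^sup>*" if "k \<le> n" for k
    using that
  proof (induction k)
    case (Suc k)
    then have "(k, Suc k) \<in> ?R" "(Suc k, k) \<in> ?R"
      by (auto simp: cycle_edges_def Let_def)
    with Suc show ?case
      by (meson Suc_leD rtrancl.rtrancl_into_rtrancl converse_rtrancl_into_rtrancl)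
  qed simp
  then have "(x, y) \<in> ?R\<^sup>*" if "x \<le> n" "y \<le> n" for x y
    using that by (meson rtrancl_trans)
  then show ?thesis
    by (simp add: cyclohedron_building_set_def connected_in_def)
qed

lemma building_set_cyclohedron: "building_set n (cyclohedron_building_set n)"
  unfolding building_set_def
proof (intro conjI ballI impI)
  fix S T
  assume "S \<in> cyclohedron_building_set n" "T \<in> cyclohedron_building_set n" "S \<inter> T \<noteq> {}"
  then show "S \<union> T \<in> cyclohedron_building_set n"
    by (auto simp: cyclohedron_building_set_def connected_in_Un)
qed (auto simp: cyclohedron_building_set_def connected_in_def)


section \<open>Agreement with geometric realisations\<close>

definition realises_nestohedron ::
    "'a::euclidean_space set \<Rightarrow> nat \<Rightarrow> nat set set \<Rightarrow> bool" where
  "realises_nestohedron P n B \<longleftrightarrow>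
     polytope P \<and>
     (\<exists>\<phi>. bij_betw \<phi> {F. F face_of P \<and> F \<noteq> {}} (nested_set_complex n B) \<and>
          (\<forall>F G. F face_of P \<and> F \<noteq> {} \<and> G face_of P \<and> G \<noteq> {} \<longrightarrow>
                 (F \<subseteq> G \<longleftrightarrow> \<phi> F \<supseteq> \<phi> G)))"

lemma chromatic_number_bij:
  assumes h: "bij_betw h A B"
    and sep: "\<And>x y. x \<in> A \<Longrightarrow> y \<in> A \<Longrightarrow> s x y \<longleftrightarrow> t (h x) (h y)"
  shows "chromatic_number A s = chromatic_number B t"
proof -
  have inj: "inj_on h A" and im: "h ` A = B" using h by (auto simp: bij_betw_def)
  have "(\<exists>f. proper_colouring A s m f) \<longleftrightarrow> (\<exists>g. proper_colouring B t m g)" for m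
  proof
    assume "\<exists>f. proper_colouring A s m f"
    then obtain f where f: "proper_colouring A s m f" ..
    have "proper_colouring B t m (f \<circ> inv_into A h)"
      unfolding proper_colouring_def
    proof (intro conjI ballI impI)
      show "f \<circ> inv_into A h \<in> B \<rightarrow> {1..m}"
        using f inj im by (auto simp: proper_colouring_def)
      fix X Y
      assume XY: "X \<in> B" "Y \<in> B" "X \<noteq> Y \<and> (f \<circ> inv_into A h) X = (f \<circ> inv_into A h) Y"
      then obtain x y where "x \<in> A" "y \<in> A" "X = h x" "Y = h y" using im by blast
      then show "t X Y" using XY f inj sep by (auto simp: proper_colouring_def)
    qed
    then show "\<exists>g. proper_colouring B t m g" by blast
  next
    assume "\<exists>g. proper_colouring B t m g"
    then obtain g where g: "proper_colouring B t m g" ..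
    have "proper_colouring A s m (g \<circ> h)"
      unfolding proper_colouring_def
    proof (intro conjI ballI impI)
      show "g \<circ> h \<in> A \<rightarrow> {1..m}"
        using g im by (auto simp: proper_colouring_def)
      fix x y
      assume xy: "x \<in> A" "y \<in> A" "x \<noteq> y \<and> (g \<circ> h) x = (g \<circ> h) y"
      then have "h x \<in> B" "h y \<in> B" "h x \<noteq> h y" using im inj by (auto simp: inj_on_def)
      then show "s x y" using xy g sep by (auto simp: proper_colouring_def)
    qed
    then show "\<exists>f. proper_colouring A s m f" by blast
  qed
  then show ?thesis by (simp add: chromatic_number_def)
qed

theorem polytope_chromatic_number_realisation:
  fixes P :: "'a::euclidean_space set"
  assumes "realises_nestohedron P n B"
  shows "polytope_chromatic_number P = nestohedron_chromatic_number n B"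
proof -
  let ?L = "{F. F face_of P \<and> F \<noteq> {}}"
  let ?K = "nested_set_complex n B"
  have P: "polytope P" using assms by (simp add: realises_nestohedron_def)
  from assms obtain \<phi> where \<phi>: "bij_betw \<phi> ?L ?K \<and>
      (\<forall>F G. F face_of P \<and> F \<noteq> {} \<and> G face_of P \<and> G \<noteq> {} \<longrightarrow> (F \<subseteq> G \<longleftrightarrow> \<phi> F \<supseteq> \<phi> G))"
    unfolding realises_nestohedron_def by (elim conjE exE) (rule that, intro conjI)
  from \<phi> have bij: "bij_betw \<phi> ?L ?K" by (rule conjunct1)
  have ord: "F \<subseteq> G \<longleftrightarrow> \<phi> G \<subseteq> \<phi> F" if "F \<in> ?L" "G \<in> ?L" for F G
    using conjunct2[OF \<phi>, rule_format, of F G] that by simp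
  have im: "\<phi> ` ?L = ?K" and inj_on: "inj_on \<phi> ?L"
    using bij by (simp_all only: bij_betw_def)
  have surj: "\<exists>F\<in>?L. \<phi> F = N" if "N \<in> ?K" for N
    using that[folded im] by (auto simp only: image_iff)
  have inK: "\<phi> F \<in> ?K" if "F \<in> ?L" for F
    using imageI[OF that, of \<phi>] by (simp only: im)
  have inj: "F = G" if "F \<in> ?L" "G \<in> ?L" "\<phi> F = \<phi> G" for F G
    using inj_onD[OF inj_on that(3,1,2)] .
  have conv: "convex P" and comp: "compact P" and poly: "polyhedron P"
    using P by (auto simp: polytope_imp_convex polytope_imp_compact polytope_imp_polyhedron)
  have emptyK: "{} \<in> ?K"
    by (auto simp: nested_set_complex_def nested_def antichain_of_def)
  have singK: "{X} \<in> ?K" if "X \<in> nestohedron_facets n B" for X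
  proof -
    have "card A < 2" if "A \<subseteq> {X}" for A using card_mono[OF _ that] by simp
    then have "\<not> antichain_of {X} A" for A
      by (auto simp: antichain_of_def not_le)
    then show ?thesis using that
      by (auto simp: nested_set_complex_def nested_def nestohedron_facets_def)
  qed
  have memK: "X \<in> nestohedron_facets n B" if "N \<in> ?K" "X \<in> N" for X N
    using that by (auto simp: nested_set_complex_def nested_def nestohedron_facets_def)
  obtain F0 where F0: "F0 \<in> ?L" "\<phi> F0 = {}" using surj[OF emptyK] by blast
  then have PL: "P \<in> ?L" using conv face_of_imp_subset face_of_refl by blast
  have "F0 = P" using ord[OF PL F0(1)] F0 face_of_imp_subset by blast
  then have phiP: "\<phi> P = {}" using F0 by simp
  have facet_sing: "\<exists>X\<in>nestohedron_facets n B. \<phi> F = {X}" if F: "F facet_of P" for F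
  proof -
    have FL: "F \<in> ?L" and FP: "F \<noteq> P" and dim: "aff_dim F = aff_dim P - 1"
      using F by (auto simp: facet_of_def)
    have "\<phi> F \<noteq> {}" using inj[OF FL PL] FP phiP by auto
    then obtain X where X: "X \<in> \<phi> F" by blast
    have Xf: "X \<in> nestohedron_facets n B" using memK[OF inK[OF FL] X] .
    obtain G where G: "G \<in> ?L" "\<phi> G = {X}" using surj[OF singK[OF Xf]] by blast
    have FG: "F \<subseteq> G" using ord[OF FL G(1)] G X by simp
    have "G \<noteq> P" using G phiP by auto
    then have GP: "aff_dim G < aff_dim P" using face_of_aff_dim_lt[OF conv, of G] G(1) by simp
    have Gface: "G face_of P" using G(1) by simp
    have "F face_of G" using face_of_face[OF Gface, of F] FL FG by simp
    moreover have "convex G" using face_of_imp_convex[OF Gface] .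
    ultimately have "F = G" using face_of_aff_dim_lt[of G F] GP dim by linarith
    then show ?thesis using G Xf by blast
  qed
  have sing_facet: "\<exists>F. F facet_of P \<and> \<phi> F = {X}" if Xf: "X \<in> nestohedron_facets n B" for X
  proof -
    obtain F where F: "F \<in> ?L" "\<phi> F = {X}" using surj[OF singK[OF Xf]] by blast
    then have "F \<noteq> P" using phiP by auto
    then obtain G where G: "G facet_of P" "F \<subseteq> G"
      using face_of_polyhedron_subset_facet[OF poly, of F] F by auto
    have GL: "G \<in> ?L" using G by (auto simp: facet_of_def)
    obtain Y where "\<phi> G = {Y}" using facet_sing[OF G(1)] by blast
    then have "\<phi> G = \<phi> F" using ord[OF F(1) GL] F G by auto
    then show ?thesis using inj[OF GL F(1)] G F by blast
  qed
  define h where "h = (\<lambda>F. the_elem (\<phi> F))"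
  have h: "\<phi> F = {h F}" "h F \<in> nestohedron_facets n B" if "F facet_of P" for F
    using facet_sing[OF that] by (auto simp: h_def)
  have "bij_betw h {F. F facet_of P} (nestohedron_facets n B)"
  proof (rule bij_betw_imageI)
    show "inj_on h {F. F facet_of P}"
    proof (rule inj_onI)
      fix F G assume FG: "F \<in> {F. F facet_of P}" "G \<in> {F. F facet_of P}" "h F = h G"
      then have "F \<in> ?L" "G \<in> ?L" "\<phi> F = \<phi> G" by (simp_all add: h facet_of_def)
      then show "F = G" by (rule inj)
    qed
    show "h ` {F. F facet_of P} = nestohedron_facets n B"
    proof (rule subset_antisym; rule subsetI)
      fix X assume "X \<in> h ` {F. F facet_of P}"
      then show "X \<in> nestohedron_facets n B" using h by blast
    next
      fix X assume "X \<in> nestohedron_facets n B"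
      then obtain F where "F facet_of P" "\<phi> F = {X}" using sing_facet by blast
      then show "X \<in> h ` {F. F facet_of P}" using h(1)[of F] by auto
    qed
  qed
  moreover have "separated_facets P F G \<longleftrightarrow> nestohedron_separated n B (h F) (h G)"
    if F: "F \<in> {F. F facet_of P}" and G: "G \<in> {F. F facet_of P}" for F G
  proof -
    have FL: "F \<in> ?L" and GL: "G \<in> ?L" using F G by (auto simp: facet_of_def)
    have hF: "\<phi> F = {h F}" and hG: "\<phi> G = {h G}" using F G h by auto
    have "(\<exists>v. v extreme_point_of P \<and> v \<in> F \<and> v \<in> G) \<longleftrightarrow>
          (\<exists>N \<in> nestohedron_vertices n B. h F \<in> N \<and> h G \<in> N)"
    proof
      assume "\<exists>v. v extreme_point_of P \<and> v \<in> F \<and> v \<in> G"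
      then obtain v where v: "v extreme_point_of P" "v \<in> F" "v \<in> G" by blast
      then have vL: "{v} \<in> ?L" by (simp add: face_of_singleton)
      have "h F \<in> \<phi> {v}" using ord[OF vL FL] v hF by simp
      moreover have "h G \<in> \<phi> {v}" using ord[OF vL GL] v hG by simp
      moreover have "\<phi> {v} \<in> nestohedron_vertices n B"
        unfolding nestohedron_vertices_def
      proof (intro CollectI conjI ballI impI)
        show "\<phi> {v} \<in> ?K" using inK[OF vL] .
        fix M assume M: "M \<in> ?K" "\<phi> {v} \<subseteq> M"
        then obtain H where H: "H \<in> ?L" "\<phi> H = M" using surj by blast
        then have "H \<subseteq> {v}" using ord[OF H(1) vL] M by simp
        then have "H = {v}" using H by blast
        then show "M = \<phi> {v}" using H by simp
      qed
      ultimately show "\<exists>N \<in> nestohedron_vertices n B. h F \<in> N \<and> h G \<in> N" by blast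
    next
      assume "\<exists>N \<in> nestohedron_vertices n B. h F \<in> N \<and> h G \<in> N"
      then obtain N where N: "N \<in> ?K" "h F \<in> N" "h G \<in> N"
        by (auto simp: nestohedron_vertices_def)
      obtain H where H: "H \<in> ?L" "\<phi> H = N" using surj[OF N(1)] by blast
      have HF: "H \<subseteq> F" using ord[OF H(1) FL] H N hF by simp
      have HG: "H \<subseteq> G" using ord[OF H(1) GL] H N hG by simp
      have Hface: "H face_of P" "H \<noteq> {}" using H(1) by simp_all
      obtain v where v: "v extreme_point_of H"
        using extreme_point_exists_convex[OF face_of_imp_compact[OF conv comp Hface(1)]
            face_of_imp_convex[OF Hface(1)] Hface(2)] .
      then have "v extreme_point_of P" "v \<in> H"
        using extreme_point_of_face[OF Hface(1), of v] by simp_all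
      then show "\<exists>v. v extreme_point_of P \<and> v \<in> F \<and> v \<in> G" using HF HG by blast
    qed
    then show ?thesis by (simp add: separated_facets_def nestohedron_separated_def)
  qed
  ultimately show ?thesis
    unfolding polytope_chromatic_number_def nestohedron_chromatic_number_def
    by (rule chromatic_number_bij)
qed

end

theory Submission
  imports Defs "HOL-Real_Asymp.Real_Asymp"
begin

text \<open>
  Write \<open>N = n + 1\<close>.  The facets of the cyclohedron are the proper arcs of a cycle with \<open>N\<close>
  vertices, \<open>N\<close> of each length \<open>l = 1, \<dots>, n\<close>.  Two of them are separated iff neither contains
  the other and their union is connected (\<open>nestohedron_separated_iff\<close>), that is, iff they are
  incomparable and touch: they overlap or are adjacent.  So a colour class is an antichain of
  pairwise touching arcs.  A class of arcs of one length \<open>l\<close> with \<open>2 * l < n\<close> has at most \<open>l + 1\<close> members,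
  so about \<open>N / (l + 1)\<close> colours are spent on them, and mixing lengths does not help; summing over
  \<open>l\<close> leads to the harmonic sum \<open>N (1/2 + \<dots> + 1/N) \<sim> n ln n\<close>, to which large \<open>l\<close> contribute only
  \<open>O(n)\<close>.

  Upper bound (\<open>cyclohedron_chromatic_number_le\<close>): arcs of the same length \<open>l\<close> whose starting
  points lie within a distance of \<open>l\<close> touch, and they cannot be comparable.  Hence \<open>l + 1\<close>
  consecutive starting points can share a colour, and \<open>\<lceil>N / (l + 1)\<rceil> = n div (l + 1) + 1\<close>
  colours suffice for length \<open>l\<close>.

  Lower bound (\<open>cyclohedron_chromatic_number_ge\<close>): give an arc of length \<open>l\<close> the weight
  \<open>1 / (l + 1)\<close> and consider only the arcs with \<open>2 * l < n\<close>.  Two such arcs cannot touch at both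
  of their ends, so a colour class behaves like a family of intervals on a line: if \<open>l\<close> is its
  least length, it has at most \<open>l + 1\<close> members (\<open>card_separated_short_facets\<close>) and weight at most
  1.  The number of colours is thus at least the total weight
  \<open>N (1/2 + 1/3 + \<dots>)\<close>, a harmonic sum with about \<open>n / 2\<close> terms; the factor 2 in its range
  costs only \<open>O(n)\<close>.
\<close>

section \<open>Separated facets of a nestohedron\<close>

text \<open>
  A pair of facets fails to be nested exactly when it is itself an antichain with union in the
  building set; and a nested pair lies in a vertex, because the complex is finite and every nested
  set extends to a maximal one.
\<close>

lemma nestohedron_separated_iff:
  assumes B: "building_set n B"
    and X: "X \<in> nestohedron_facets n B" and Y: "Y \<in> nestohedron_facets n B" and "X \<noteq> Y"
  shows "nestohedron_separated n B X Y \<longleftrightarrow> \<not> X \<subseteq> Y \<and> \<not> Y \<subseteq> X \<and> X \<union> Y \<in> B"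
proof
  assume XY: "\<not> X \<subseteq> Y \<and> \<not> Y \<subseteq> X \<and> X \<union> Y \<in> B"
  have False if v: "v \<in> nestohedron_vertices n B" "X \<in> v" "Y \<in> v" for v
  proof -
    have "antichain_of v {X, Y}"
      using XY v(2,3) \<open>X \<noteq> Y\<close> by (simp add: antichain_of_def)
    moreover have "nested B v"
      using v(1) by (simp add: nestohedron_vertices_def nested_set_complex_def)
    ultimately have "\<Union>{X, Y} \<notin> B" unfolding nested_def by blast
    with XY show False by simp
  qed
  then show "nestohedron_separated n B X Y" unfolding nestohedron_separated_def by blast
next
  assume sep: "nestohedron_separated n B X Y"
  show "\<not> X \<subseteq> Y \<and> \<not> Y \<subseteq> X \<and> X \<union> Y \<in> B"
  proof (rule ccontr)
    assume not: "\<not> (\<not> X \<subseteq> Y \<and> \<not> Y \<subseteq> X \<and> X \<union> Y \<in> B)"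
    have "\<Union>A \<notin> B" if A: "antichain_of {X, Y} A" for A
    proof -
      have "A = {X, Y}"
        using A \<open>X \<noteq> Y\<close> by (intro card_seteq) (auto simp: antichain_of_def)
      then show ?thesis using A not \<open>X \<noteq> Y\<close> by (auto simp: antichain_of_def)
    qed
    then have XY: "{X, Y} \<in> nested_set_complex n B"
      using X Y by (auto simp: nested_set_complex_def nested_def nestohedron_facets_def)
    have "B \<subseteq> Pow {0..n}" using B by (auto simp: building_set_def)
    then have "finite B" by (rule finite_subset) simp
    then have "finite (nested_set_complex n B)"
      by (rule finite_subset[rotated, OF finite_Pow_iff[THEN iffD2]])
        (auto simp: nested_set_complex_def nested_def)
    from finite_has_maximal2[OF this XY] obtain v where
      "v \<in> nested_set_complex n B" "{X, Y} \<subseteq> v"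
      "\<forall>M\<in>nested_set_complex n B. v \<subseteq> M \<longrightarrow> v = M" by blast
    then have "v \<in> nestohedron_vertices n B" "X \<in> v" "Y \<in> v"
      by (auto simp: nestohedron_vertices_def)
    with sep show False by (auto simp: nestohedron_separated_def)
  qed
qed

section \<open>Arcs of a cycle\<close>

text \<open>
  The parameters are a starting point and a length, and the starting point may be any natural number,
  not only a residue.  Thus arcs are images of intervals, and as long as everything stays inside one
  window of \<open>N\<close> consecutive numbers, where reduction modulo \<open>N\<close> is injective, questions about
  arcs are questions about intervals.  The parameters are not unique; for \<open>l \<ge> N\<close> the arc is the
  whole cycle.
\<close>

definition cycle_arc :: "nat \<Rightarrow> nat \<Rightarrow> nat \<Rightarrow> nat set" where
  "cycle_arc N s l = (\<lambda>i. i mod N) ` {s..<s + l}"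

lemma inj_on_mod_window: "inj_on (\<lambda>i. i mod N) {s..<s + N}" for N s :: nat
proof (rule linorder_inj_onI')
  fix i j assume ij: "i \<in> {s..<s + N}" "j \<in> {s..<s + N}" "i < j"
  show "i mod N \<noteq> j mod N"
  proof
    assume "i mod N = j mod N"
    then have "N dvd j - i" using ij by (metis mod_eq_dvd_iff_nat less_imp_le)
    then have "N \<le> j - i" using ij by (intro dvd_imp_le) auto
    then show False using ij by auto
  qed
qed

lemma mod_mem_cycle_arc_iff:
  assumes "s \<le> x" "x < s + N" "s \<le> t" "t + l \<le> s + N"
  shows "x mod N \<in> cycle_arc N t l \<longleftrightarrow> t \<le> x \<and> x < t + l"
  using inj_on_image_mem_iff[OF inj_on_mod_window[of N s], of x "{t..<t + l}"] assms
  by (auto simp: cycle_arc_def)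

lemma card_cycle_arc: "l \<le> N \<Longrightarrow> card (cycle_arc N s l) = l"
  unfolding cycle_arc_def
  by (subst card_image) (auto intro: inj_on_subset[OF inj_on_mod_window[of N s]])

lemma cycle_arc_add_mult: "cycle_arc N (s + k * N) l = cycle_arc N s l"
proof -
  have "{s + k * N..<s + k * N + l} = (\<lambda>i. i + k * N) ` {s..<s + l}"
    by (simp add: add_ac)
  then show ?thesis by (simp only: cycle_arc_def image_image mod_mult_self1)
qed

lemma cycle_arc_mod: "cycle_arc N (s mod N) l = cycle_arc N s l"
  using cycle_arc_add_mult[of N "s mod N" "s div N" l] by simp

lemma cycle_arc_mono: "t \<le> s \<Longrightarrow> s + l \<le> t + k \<Longrightarrow> cycle_arc N s l \<subseteq> cycle_arc N t k"
  unfolding cycle_arc_def by (intro image_mono) auto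

lemma cycle_arc_Un:
  "s \<le> t \<Longrightarrow> t \<le> s + l \<Longrightarrow> s + l \<le> t + k \<Longrightarrow>
    cycle_arc N s l \<union> cycle_arc N t k = cycle_arc N s (t + k - s)"
  unfolding cycle_arc_def image_Un[symmetric] by (rule arg_cong[where f = "image _"]) auto

text \<open>
  A nonempty proper arc determines its starting point as its only vertex whose predecessor is not in
  the arc.
\<close>

lemma inj_on_cycle_arc:
  assumes "0 < l" "l < N"
  shows "inj_on (\<lambda>s. cycle_arc N s l) {..<N}"
proof (rule linorder_inj_onI')
  fix s t assume st: "s \<in> {..<N}" "t \<in> {..<N}" "s < t"
  show "cycle_arc N s l \<noteq> cycle_arc N t l"
  proof
    assume eq: "cycle_arc N s l = cycle_arc N t l"
    have "(t + N - 1) mod N \<notin> cycle_arc N t l"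
      using mod_mem_cycle_arc_iff[of t "t + N - 1" N t l] assms by auto
    moreover have "(t + N - 1) mod N = (t - 1) mod N"
      using st mod_add_self2[of "t - 1" N] by (simp del: mod_add_self2)
    ultimately have "\<not> t - 1 < s + l"
      using mod_mem_cycle_arc_iff[of s "t - 1" N s l] st assms eq by auto
    moreover have "t mod N \<in> cycle_arc N t l"
      using mod_mem_cycle_arc_iff[of t t N t l] assms by auto
    then have "t < s + l"
      using mod_mem_cycle_arc_iff[of s t N s l] st assms eq by auto
    ultimately show False by simp
  qed
qed

lemma cycle_edges_iff:
  "(x, y) \<in> cycle_edges n \<longleftrightarrow> x \<le> n \<and> y \<le> n \<and> (y = Suc x mod Suc n \<or> x = Suc y mod Suc n)"
  by (fastforce simp: cycle_edges_def Let_def mod_Suc split: if_splits)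

lemma cycle_arc_in_building_set:
  assumes "0 < l"
  shows "cycle_arc (Suc n) s l \<in> cyclohedron_building_set n"
proof -
  have "connected_in (cycle_edges n) (cycle_arc (Suc n) s l)"
    using assms
  proof (induction l rule: nat_induct_non_zero)
    case 1
    show ?case by (simp add: cycle_arc_def connected_in_def)
  next
    case (Suc l)
    let ?x = "(s + l - 1) mod Suc n" and ?y = "(s + l) mod Suc n"
    have "?y = Suc ?x mod Suc n" using Suc.hyps by (simp add: mod_Suc_eq)
    then have "(?x, ?y) \<in> cycle_edges n" "(?y, ?x) \<in> cycle_edges n"
      by (auto simp: cycle_edges_iff less_Suc_eq_le[symmetric])
    then have "connected_in (cycle_edges n) {?x, ?y}"
      by (auto simp: connected_in_def intro!: r_into_rtrancl)
    moreover have "?x \<in> cycle_arc (Suc n) s l" using Suc.hyps by (auto simp: cycle_arc_def)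
    moreover have "cycle_arc (Suc n) s (Suc l) = cycle_arc (Suc n) s l \<union> {?x, ?y}"
      using calculation(2) by (auto simp: cycle_arc_def atLeastLessThanSuc)
    ultimately show ?case
      using connected_in_Un[OF Suc.IH, of "{?x, ?y}"] by (metis IntI empty_iff insertI1)
  qed
  moreover have "cycle_arc (Suc n) s l \<subseteq> {0..n}"
    by (auto simp: cycle_arc_def less_Suc_eq_le[symmetric])
  ultimately show ?thesis
    using assms by (auto simp: cyclohedron_building_set_def cycle_arc_def)
qed

text \<open>
  The two vertices next to an arc are its only gates: a path that starts in the arc and avoids them
  never leaves it.  The lemma serves both to show that connected sets are arcs and to show that a
  union of two arcs with gaps on both sides is not connected.
\<close>

lemma connected_eq_cycle_arc:
  assumes conn: "connected_in (cycle_edges n) S" and sub: "cycle_arc (Suc n) s l \<subseteq> S" and "0 < l"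
    and before: "(s + n) mod Suc n \<notin> S" and after: "(s + l) mod Suc n \<notin> S"
  shows "S = cycle_arc (Suc n) s l"
proof (rule antisym[OF subsetI sub])
  fix x assume "x \<in> S"
  have s: "s mod Suc n \<in> cycle_arc (Suc n) s l" using \<open>0 < l\<close> by (auto simp: cycle_arc_def)
  then have "(s mod Suc n, x) \<in> (Restr (cycle_edges n) S)\<^sup>*"
    using conn sub \<open>x \<in> S\<close> by (auto simp: connected_in_def)
  then show "x \<in> cycle_arc (Suc n) s l"
  proof (induction rule: rtrancl_induct)
    case (step y z)
    then obtain i where i: "s \<le> i" "i < s + l" "y = i mod Suc n" by (auto simp: cycle_arc_def)
    from step have "z \<in> S" and e: "(y, z) \<in> cycle_edges n" by auto
    from e consider "z = Suc i mod Suc n" | "y = Suc z mod Suc n" "z \<le> n"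
      by (auto simp: cycle_edges_iff i(3) mod_Suc_eq)
    then show ?case
    proof cases
      case 1
      then have "Suc i \<noteq> s + l" using after \<open>z \<in> S\<close> by auto
      then show ?thesis using 1 i unfolding cycle_arc_def by (intro image_eqI[of _ _ "Suc i"]) auto
    next
      case 2
      \<comment> \<open>Adding \<open>n\<close> is going one step back, without truncated subtraction.\<close>
      have "z = (Suc z mod Suc n + n) mod Suc n"
        using 2(2) by (simp only: mod_add_left_eq)
          (simp add: less_Suc_eq_le add_Suc_right[symmetric] del: add_Suc_right)
      also have "\<dots> = (i + n) mod Suc n"
        using 2 i by (simp only: mod_add_left_eq flip: 2(1))
      finally have z: "z = (i + n) mod Suc n" .
      then have "i \<noteq> s" using before \<open>z \<in> S\<close> by auto
      then have "i + n = (i - 1) + Suc n" "i - 1 \<in> {s..<s + l}" using i by auto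
      then show ?thesis using z unfolding cycle_arc_def
        by (intro image_eqI[of _ _ "i - 1"]) (simp_all only: mod_add_self2)
    qed
  qed (rule s)
qed

text \<open>
  Going round the cycle from a vertex outside the set, the first vertex \<open>s\<close> of the set and the
  first vertex after \<open>s\<close> that is again outside delimit an arc inside the set, which by
  \<open>connected_eq_cycle_arc\<close> is all of it.
\<close>

lemma cyclohedron_facet_eq_cycle_arc:
  assumes "X \<in> nestohedron_facets n (cyclohedron_building_set n)"
  shows "0 < card X \<and> card X \<le> n \<and> (\<exists>s\<le>n. X = cycle_arc (Suc n) s (card X))"
proof -
  from assms have X: "X \<noteq> {}" "X \<subseteq> {0..n}" "X \<noteq> {0..n}" "connected_in (cycle_edges n) X"
    by (auto simp: nestohedron_facets_def cyclohedron_building_set_def)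
  then obtain z x where z: "z \<le> n" "z \<notin> X" and x: "x \<le> n" "x \<in> X" by fastforce
  define s where "s = (LEAST s. z < s \<and> s mod Suc n \<in> X)"
  have "z < x + Suc n \<and> (x + Suc n) mod Suc n \<in> X"
    using x z mod_add_self2[of x "Suc n"] by (simp del: mod_add_self2)
  then have "z < s \<and> s mod Suc n \<in> X"
    unfolding s_def by (rule LeastI)
  then have s: "z < s" "s mod Suc n \<in> X" by auto
  have before: "(s + n) mod Suc n \<notin> X"
  proof
    assume "(s + n) mod Suc n \<in> X"
    moreover have "s + n = (s - 1) + Suc n" using s by auto
    ultimately have m: "(s - 1) mod Suc n \<in> X" by (simp only: mod_add_self2)
    then have "s - 1 \<noteq> z" using z by auto
    then have "s \<le> s - 1" using m s(1) unfolding s_def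
      by (intro Least_le) (simp add: s_def[symmetric])
    then show False using s by simp
  qed
  define l where "l = (LEAST l. (s + l) mod Suc n \<notin> X)"
  have l: "(s + l) mod Suc n \<notin> X" unfolding l_def using before by (rule LeastI)
  have "l \<le> n" unfolding l_def using before by (rule Least_le)
  have "0 < l" using l s by (cases l) auto
  have "cycle_arc (Suc n) s l \<subseteq> X"
  proof
    fix y assume "y \<in> cycle_arc (Suc n) s l"
    then obtain i where "i < l" "y = (s + i) mod Suc n"
      by (auto simp: cycle_arc_def) (metis le_add_diff_inverse nat_add_left_cancel_less)
    then show "y \<in> X" using not_less_Least[of i] by (auto simp: l_def)
  qed
  then have "X = cycle_arc (Suc n) s l" using connected_eq_cycle_arc X(4) \<open>0 < l\<close> before l by blast
  moreover from this have "card X = l" using \<open>l \<le> n\<close> by (simp add: card_cycle_arc)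
  moreover have "X = cycle_arc (Suc n) (s mod Suc n) l" using calculation(1) by (simp add: cycle_arc_mod)
  moreover have "s mod Suc n \<le> n" using mod_less_divisor[of "Suc n" s] by linarith
  ultimately show ?thesis using \<open>0 < l\<close> \<open>l \<le> n\<close> by metis
qed

text \<open>
  If \<open>s \<le> t < s + N\<close>, the conclusion says that the second arc starts at the latest right after the
  end of the first, or ends at the earliest right before the start of the next copy of the first.
\<close>

lemma connected_Un_cycle_arcs_touch:
  assumes un: "cycle_arc (Suc n) s a \<union> cycle_arc (Suc n) t b \<in> cyclohedron_building_set n"
    and "0 < a" "0 < b"
  shows "t \<le> s + a \<or> s + Suc n \<le> t + b"
proof (rule ccontr)
  assume "\<not> ?thesis"
  then have st: "s + a < t" "t + b < s + Suc n" by auto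
  let ?S = "cycle_arc (Suc n) s a \<union> cycle_arc (Suc n) t b"
  have mem: "x mod Suc n \<in> ?S \<longleftrightarrow> x \<in> {s..<s + a} \<union> {t..<t + b}"
    if "s \<le> x" "x < s + Suc n" for x
    using mod_mem_cycle_arc_iff[of s x "Suc n"] that st by auto
  have "?S = cycle_arc (Suc n) s a"
  proof (rule connected_eq_cycle_arc)
    show "connected_in (cycle_edges n) ?S" using un by (simp add: cyclohedron_building_set_def)
    show "(s + n) mod Suc n \<notin> ?S" "(s + a) mod Suc n \<notin> ?S"
      using mem[of "s + n"] mem[of "s + a"] st by auto
  qed (use \<open>0 < a\<close> in auto)
  moreover have "t mod Suc n \<in> ?S" using mem[of t] st \<open>0 < b\<close> by auto
  ultimately show False
    using mod_mem_cycle_arc_iff[of s t "Suc n" s a] st by auto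
qed

section \<open>Bounds for chromatic numbers\<close>

lemma chromatic_number_le_card:
  assumes "finite C" "g \<in> F \<rightarrow> C"
    and "\<And>X Y. X \<in> F \<Longrightarrow> Y \<in> F \<Longrightarrow> X \<noteq> Y \<Longrightarrow> g X = g Y \<Longrightarrow> sep X Y"
  shows "chromatic_number F sep \<le> card C"
proof -
  obtain h where h: "bij_betw h C {1..card C}"
    using finite_same_card_bij[of C "{1..card C}"] assms(1) by auto
  then have "proper_colouring F sep (card C) (h \<circ> g)"
    using assms(2,3) by (auto simp: proper_colouring_def bij_betw_def inj_on_def Pi_iff)
  then show ?thesis unfolding chromatic_number_def by (intro Least_le) blast
qed

lemma proper_colouring_chromatic_number:
  assumes "finite F"
  obtains f where "proper_colouring F sep (chromatic_number F sep) f"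
proof -
  obtain h where h: "bij_betw h F {1..card F}"
    using finite_same_card_bij[of F "{1..card F}"] assms by auto
  then have "proper_colouring F sep (card F) h"
    by (auto simp: proper_colouring_def bij_betw_def inj_on_def)
  then have "\<exists>m f. proper_colouring F sep m f" by blast
  then have "\<exists>f. proper_colouring F sep (chromatic_number F sep) f"
    unfolding chromatic_number_def by (rule LeastI_ex)
  then show thesis using that by blast
qed

text \<open>
  The weak duality between fractional cliques and colourings: a weight function for which no colour
  class weighs more than 1 has a total weight of at most the number of colours.
\<close>

lemma weight_le_chromatic_number:
  fixes w :: "'f \<Rightarrow> real"
  assumes "finite F" "S \<subseteq> F"
    and weight: "\<And>K. K \<subseteq> S \<Longrightarrow> (\<And>X Y. X \<in> K \<Longrightarrow> Y \<in> K \<Longrightarrow> X \<noteq> Y \<Longrightarrow> sep X Y) \<Longrightarrow> sum w K \<le> 1"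
  shows "sum w S \<le> chromatic_number F sep"
proof -
  let ?m = "chromatic_number F sep"
  obtain f where f: "proper_colouring F sep ?m f"
    using proper_colouring_chromatic_number[OF assms(1)] .
  have "finite S" using assms(1,2) by (rule rev_finite_subset)
  have "f ` S \<subseteq> {1..?m}" using f \<open>S \<subseteq> F\<close> by (auto simp: proper_colouring_def)
  then have "sum w S = (\<Sum>c\<in>{1..?m}. sum w {X \<in> S. f X = c})"
    using \<open>finite S\<close> by (simp add: sum.group)
  also have "\<dots> \<le> (\<Sum>c\<in>{1..?m}. 1)"
  proof (intro sum_mono weight)
    fix c X Y assume "X \<in> {X \<in> S. f X = c}" "Y \<in> {X \<in> S. f X = c}" "X \<noteq> Y"
    moreover from this have "X \<in> F" "Y \<in> F" "f X = f Y" using \<open>S \<subseteq> F\<close> by auto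
    ultimately show "sep X Y" using f by (simp add: proper_colouring_def)
  qed auto
  finally show ?thesis by simp
qed

section \<open>Colourings of the cyclohedron\<close>

text \<open>
  The colour of an arc consists of its length \<open>l\<close> and of the block of \<open>l + 1\<close> consecutive
  numbers in which it starts.
\<close>

lemma cyclohedron_chromatic_number_le:
  "cyclohedron_chromatic_number n \<le> (\<Sum>l = 1..n. Suc (n div Suc l))"
proof -
  let ?B = "cyclohedron_building_set n"
  let ?F = "nestohedron_facets n ?B"
  have "\<forall>X\<in>?F. \<exists>s. s \<le> n \<and> X = cycle_arc (Suc n) s (card X)"
    using cyclohedron_facet_eq_cycle_arc by blast
  then obtain s where s: "\<And>X. X \<in> ?F \<Longrightarrow> s X \<le> n"
      "\<And>X. X \<in> ?F \<Longrightarrow> X = cycle_arc (Suc n) (s X) (card X)"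
    by metis
  let ?C = "SIGMA l:{1..n}. {..n div Suc l}"
  let ?g = "\<lambda>X. (card X, s X div Suc (card X))"
  have "chromatic_number ?F (nestohedron_separated n ?B) \<le> card ?C"
  proof (rule chromatic_number_le_card)
    show "?g \<in> ?F \<rightarrow> ?C"
    proof
      fix X assume "X \<in> ?F"
      with cyclohedron_facet_eq_cycle_arc[OF this] s(1)[OF this] show "?g X \<in> ?C"
        by (auto intro: div_le_mono)
    qed
    have sep: "nestohedron_separated n ?B X Y"
      if XY: "X \<in> ?F" "Y \<in> ?F" "X \<noteq> Y" "?g X = ?g Y" and le: "s X \<le> s Y" for X Y
    proof -
      from XY have card: "card Y = card X" and q: "s Y div Suc (card X) = s X div Suc (card X)" by auto
      have pos: "0 < card X" using cyclohedron_facet_eq_cycle_arc[OF XY(1)] by simp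
      then have fin: "finite X" "finite Y" using card by (auto intro: card_ge_0_finite)
      \<comment> \<open>Starting points in the same block differ by at most the length, so that the arcs touch.\<close>
      have "s Y \<le> s X + card X"
        using div_mult_mod_eq[of "s X" "Suc (card X)"] div_mult_mod_eq[of "s Y" "Suc (card X)"]
          mod_less_divisor[of "Suc (card X)" "s Y", OF zero_less_Suc]
        unfolding q by linarith
      then have "X \<union> Y = cycle_arc (Suc n) (s X) (s Y + card X - s X)"
        using cycle_arc_Un[of "s X" "s Y" "card X" "card X" "Suc n"] s(2)[OF XY(1)] s(2)[OF XY(2)] le card by simp
      then have "X \<union> Y \<in> ?B"
        using cycle_arc_in_building_set[of "s Y + card X - s X"] pos le by simp
      then show ?thesis
        using nestohedron_separated_iff[OF building_set_cyclohedron XY(1-3)] XY(3)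
          card fin card_subset_eq[of X Y] card_subset_eq[of Y X]
        by auto
    qed
    show "nestohedron_separated n ?B X Y"
      if "X \<in> ?F" "Y \<in> ?F" "X \<noteq> Y" "?g X = ?g Y" for X Y
      using sep[of X Y] sep[of Y X] that
      by (cases "s X \<le> s Y") (auto simp: nestohedron_separated_def)
  qed simp
  then show ?thesis
    by (simp add: cyclohedron_chromatic_number_def nestohedron_chromatic_number_def)
qed

text \<open>
  Let \<open>X\<close> start at \<open>s\<close> and have the least length \<open>a\<close>.  Every other member touches \<open>X\<close> but does
  not contain it, so it either starts at \<open>s + i\<close> with \<open>1 \<le> i \<le> a\<close> or ends at
  \<open>s + i - 2\<close> with \<open>1 \<le> i \<le> a\<close>.  The number \<open>i\<close> identifies the member: two members with the
  same starting point, or with the same last vertex, are comparable, and a member that starts at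
  \<open>s + i\<close> does not touch one that ends at \<open>s + i - 2\<close>.  This last step uses that the arcs are
  short, since long arcs could also meet on the opposite side of the cycle.
\<close>

lemma card_separated_short_facets:
  assumes K: "K \<subseteq> nestohedron_facets n (cyclohedron_building_set n)"
    and sep: "\<And>Y Z. Y \<in> K \<Longrightarrow> Z \<in> K \<Longrightarrow> Y \<noteq> Z \<Longrightarrow> nestohedron_separated n (cyclohedron_building_set n) Y Z"
    and short: "\<And>Y. Y \<in> K \<Longrightarrow> 2 * card Y < n"
    and X: "X \<in> K" and least: "\<And>Y. Y \<in> K \<Longrightarrow> card X \<le> card Y"
  shows "card K \<le> Suc (card X)"
proof -
  let ?B = "cyclohedron_building_set n" and ?N = "Suc n" and ?a = "card X"
  have incomparable: "\<not> Y \<subseteq> Z" and union: "Y \<union> Z \<in> ?B" if "Y \<in> K" "Z \<in> K" "Y \<noteq> Z" for Y Z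
    using nestohedron_separated_iff[OF building_set_cyclohedron subsetD[OF K that(1)]
        subsetD[OF K that(2)] that(3)] sep[OF that] by simp_all
  have pos: "0 < card Y" if "Y \<in> K" for Y
    using cyclohedron_facet_eq_cycle_arc[OF subsetD[OF K that]] by simp
  obtain s where s: "s \<le> n" "X = cycle_arc ?N s ?a"
    using cyclohedron_facet_eq_cycle_arc[OF subsetD[OF K X]] by blast
  \<comment> \<open>All members are described by starting points in the window \<open>{s..<s + N}\<close>.\<close>
  have "\<exists>t. s \<le> t \<and> t < s + ?N \<and> Y = cycle_arc ?N t (card Y)" if Y: "Y \<in> K" for Y
  proof -
    obtain t where t: "t \<le> n" "Y = cycle_arc ?N t (card Y)"
      using cyclohedron_facet_eq_cycle_arc[OF subsetD[OF K Y]] by blast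
    show ?thesis
    proof (cases "s \<le> t")
      case False
      then show ?thesis using t s cycle_arc_add_mult[of ?N t 1 "card Y"] by (intro exI[of _ "t + ?N"]) auto
    qed (use t s in auto)
  qed
  then obtain t where t: "\<And>Y. Y \<in> K \<Longrightarrow> s \<le> t Y" "\<And>Y. Y \<in> K \<Longrightarrow> t Y < s + ?N"
      "\<And>Y. Y \<in> K \<Longrightarrow> Y = cycle_arc ?N (t Y) (card Y)"
    by metis
  have touch: "t Z \<le> t Y + card Y \<or> t Y + ?N \<le> t Z + card Z" if "Y \<in> K" "Z \<in> K" "Y \<noteq> Z" for Y Z
    using connected_Un_cycle_arcs_touch[of n "t Y" "card Y" "t Z" "card Z"] union[OF that] pos t(3) that by metis
  have not_inside: "\<not> (t Z \<le> t Y \<and> t Y + card Y \<le> t Z + card Z)" if "Y \<in> K" "Z \<in> K" "Y \<noteq> Z" for Y Z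
    using cycle_arc_mono[of "t Z" "t Y" "card Y" "card Z" ?N] incomparable[OF that] t(3) that by metis
  \<comment> \<open>The number \<open>i\<close>; an arc not starting in or right after \<open>X\<close> has to reach the next copy of \<open>X\<close>,
    which starts at \<open>s + N\<close>, and its last vertex is \<open>t Y + card Y - 1 = s + N + i - 2\<close>.\<close>
  define \<phi> where "\<phi> Y = (if t Y \<le> s + ?a then t Y - s else t Y + card Y + 1 - (s + ?N))" for Y
  have bounds: "s < t Y" "t Y \<le> s + ?a \<or> s + ?N \<le> t Y + card Y" "t Y + card Y < s + ?N + ?a"
    if Y: "Y \<in> K - {X}" for Y
  proof -
    have "cycle_arc ?N s ?a \<subseteq> cycle_arc ?N (t Y) (card Y)" if "s = t Y"
      using that Y least by (intro cycle_arc_mono) auto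
    then show "s < t Y" using incomparable[of X Y] X Y s t(1)[of Y] t(3)[of Y] by (cases "s = t Y") auto
    have "cycle_arc ?N (s + 1 * ?N) ?a \<subseteq> cycle_arc ?N (t Y) (card Y)" if "s + ?N + ?a \<le> t Y + card Y"
      using that t(2)[of Y] Y by (intro cycle_arc_mono) auto
    then show "t Y + card Y < s + ?N + ?a"
      using incomparable[of X Y] X Y s(2) t(3)[of Y] cycle_arc_add_mult[of ?N s 1 ?a]
      by (metis DiffD1 DiffD2 insertI1 not_le_imp_less)
    show "t Y \<le> s + ?a \<or> s + ?N \<le> t Y + card Y"
      using connected_Un_cycle_arcs_touch[of n s ?a "t Y" "card Y"] union[of X Y] pos X Y s(2) t(3)[of Y] by auto
  qed
  have "\<phi> ` (K - {X}) \<subseteq> {1..?a}"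
  proof
    fix k assume "k \<in> \<phi> ` (K - {X})"
    then obtain Y where "Y \<in> K - {X}" "k = \<phi> Y" by blast
    with bounds[of Y] show "k \<in> {1..?a}" by (auto simp: \<phi>_def)
  qed
  moreover have "inj_on \<phi> (K - {X})"
  proof (rule inj_onI, rule ccontr)
    fix Y Z assume YZ: "Y \<in> K - {X}" "Z \<in> K - {X}" "\<phi> Y = \<phi> Z" "Y \<noteq> Z"
    then have mem: "Y \<in> K" "Z \<in> K" by auto
    \<comment> \<open>If both values come from starting points, or both from end points, then one of the arcs is
      contained in the other.  Otherwise one arc ends just before the vertex that precedes the start
      of the other, so that they could only touch at their far ends, for which together they are too
      short.\<close>
    show False
      using YZ(3) bounds[OF YZ(1)] bounds[OF YZ(2)] short[OF mem(1)] short[OF mem(2)]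
        touch[OF mem YZ(4)] touch[OF mem(2,1) YZ(4)[symmetric]]
        not_inside[OF mem YZ(4)] not_inside[OF mem(2,1) YZ(4)[symmetric]]
      by (auto simp: \<phi>_def split: if_splits)
  qed
  ultimately have "card (K - {X}) \<le> card {1..?a}" by (intro card_inj_on_le) auto
  then show ?thesis using X by (simp add: card_Diff_singleton)
qed

text \<open>
  In a colour class of \<open>k\<close> short arcs all lengths are at least \<open>k - 1\<close>, so each arc has weight at
  most \<open>1 / k\<close>.
\<close>

lemma cyclohedron_chromatic_number_ge:
  "real (Suc n) * (\<Sum>l = 1..(n - 1) div 2. 1 / real (Suc l)) \<le> cyclohedron_chromatic_number n"
proof -
  let ?B = "cyclohedron_building_set n" and ?L = "(n - 1) div 2"
  let ?F = "nestohedron_facets n ?B"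
  let ?P = "{1..?L} \<times> {..<Suc n}"
  let ?arc = "\<lambda>(l, s). cycle_arc (Suc n) s l"
  let ?w = "\<lambda>X. 1 / real (Suc (card X))"
  have short: "2 * l < n" if "l \<in> {1..?L}" for l
  proof -
    from that have "1 \<le> l" "l \<le> ?L" by (simp_all only: atLeastAtMost_iff)
    then show ?thesis by linarith
  qed
  have card: "card (cycle_arc (Suc n) s l) = l" if "l \<in> {1..?L}" for s l
    using short[OF that] by (intro card_cycle_arc) simp
  have inj: "inj_on ?arc ?P"
  proof (rule inj_onI)
    fix p q assume pq: "p \<in> ?P" "q \<in> ?P" "?arc p = ?arc q"
    obtain l s k t where p: "p = (l, s)" and q: "q = (k, t)" by (cases p, cases q)
    have "l = k" using card[of l s] card[of k t] pq p q by simp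
    moreover have "s = t"
      using inj_onD[OF inj_on_cycle_arc[of k "Suc n"], of s t] short[of k] pq p q \<open>l = k\<close> by simp
    ultimately show "p = q" using p q by simp
  qed
  have "?B \<subseteq> Pow {0..n}" by (auto simp: cyclohedron_building_set_def)
  then have fin: "finite ?F" unfolding nestohedron_facets_def by (auto intro: finite_subset)
  have facet: "?arc ` ?P \<subseteq> ?F"
  proof clarify
    fix l s assume l: "l \<in> {1..?L}"
    then have "cycle_arc (Suc n) s l \<noteq> {0..n}" using card[OF l, of s] by auto
    then show "cycle_arc (Suc n) s l \<in> ?F"
      using cycle_arc_in_building_set[of l n s] l by (auto simp: nestohedron_facets_def)
  qed
  have "real (Suc n) * (\<Sum>l = 1..?L. 1 / real (Suc l)) = (\<Sum>l = 1..?L. \<Sum>s<Suc n. 1 / real (Suc l))"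
    by (simp add: sum_distrib_left)
  also have "\<dots> = (\<Sum>(l, s)\<in>?P. 1 / real (Suc l))"
    by (rule sum.cartesian_product)
  also have "\<dots> = (\<Sum>p\<in>?P. ?w (?arc p))"
    by (intro sum.cong) (auto simp: card)
  also have "\<dots> = sum ?w (?arc ` ?P)"
    by (simp only: sum.reindex[OF inj] o_def)
  also have "\<dots> \<le> chromatic_number ?F (nestohedron_separated n ?B)"
  proof (rule weight_le_chromatic_number[OF fin facet])
    fix K assume K: "K \<subseteq> ?arc ` ?P"
      and sep: "\<And>X Y. X \<in> K \<Longrightarrow> Y \<in> K \<Longrightarrow> X \<noteq> Y \<Longrightarrow> nestohedron_separated n ?B X Y"
    show "sum ?w K \<le> 1"
    proof (cases "K = {}")
      case False
      have "finite K" using K by (rule finite_subset) simp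
      obtain X where X: "X \<in> K" "\<And>Y. Y \<in> K \<Longrightarrow> card X \<le> card Y"
        using False ex_has_least_nat[of "\<lambda>X. X \<in> K" _ card] by blast
      have "2 * card Y < n" if Y: "Y \<in> K" for Y
      proof -
        obtain l s where "l \<in> {1..?L}" "Y = cycle_arc (Suc n) s l"
          using subsetD[OF K Y] by (elim imageE) auto
        then show ?thesis using short card by simp
      qed
      then have "card K \<le> Suc (card X)"
        using card_separated_short_facets[of K n X] K facet sep X by blast
      have "sum ?w K \<le> (\<Sum>Y\<in>K. ?w X)"
        using X by (intro sum_mono divide_left_mono) auto
      also have "\<dots> \<le> 1"
        using \<open>card K \<le> Suc (card X)\<close> by simp
      finally show ?thesis .
    qed simp
  qed
  finally show ?thesis
    by (simp add: cyclohedron_chromatic_number_def nestohedron_chromatic_number_def)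
qed

section \<open>Asymptotics\<close>

lemma sum_inverse_Suc_eq_harm: "(\<Sum>l = 1..n. 1 / real (Suc l)) = harm (Suc n) - 1"
  by (induction n) (simp_all add: harm_expand harm_Suc inverse_eq_divide)

text \<open>
  The bound \<open>harm m \<le> ln m + 1\<close> is the monotonicity of \<open>harm m - ln m\<close>, compared with \<open>m = 1\<close>.
\<close>

lemma cyclohedron_chromatic_number_upper:
  "real (cyclohedron_chromatic_number n) \<le> real n * (ln (real n + 1) + 1)"
proof -
  have "real (cyclohedron_chromatic_number n) \<le> (\<Sum>l = 1..n. 1 + real (n div Suc l))"
    using cyclohedron_chromatic_number_le[of n, THEN of_nat_mono[where 'a = real]] by simp
  also have "\<dots> \<le> (\<Sum>l = 1..n. 1 + real n * (1 / real (Suc l)))"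
    using of_nat_div_le_of_nat[of n "Suc _", where 'a = real] by (intro sum_mono) simp
  also have "\<dots> = real n * harm (Suc n)"
    by (simp only: sum.distrib sum_distrib_left[symmetric] sum_inverse_Suc_eq_harm) (simp add: algebra_simps)
  also have "\<dots> \<le> real n * (ln (real n + 1) + 1)"
    using decseqD[OF decseq_harm_diff_ln, of 0 n]
    by (intro mult_left_mono) (simp_all add: harm_expand add_ac)
  finally show ?thesis .
qed

lemma cyclohedron_chromatic_number_lower:
  "(real n + 1) * (ln (real n / 2 + 1) - 1) \<le> real (cyclohedron_chromatic_number n)"
proof -
  let ?L = "(n - 1) div 2"
  have "real n \<le> 2 * real ?L + 2" by linarith
  then have "ln (real n / 2 + 1) \<le> ln (real (Suc ?L) + 1)" by (subst ln_le_cancel_iff) auto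
  also have "\<dots> \<le> harm (Suc ?L)" by (rule ln_le_harm)
  finally have "(real n + 1) * (ln (real n / 2 + 1) - 1) \<le> real (Suc n) * (harm (Suc ?L) - 1)"
    using mult_left_mono[of "ln (real n / 2 + 1) - 1" "harm (Suc ?L) - 1" "real n + 1"]
    by (simp add: add.commute)
  then show ?thesis
    using cyclohedron_chromatic_number_ge[of n] by (simp only: sum_inverse_Suc_eq_harm)
qed

theorem corollary5p3:
  shows "(\<lambda>n. real (cyclohedron_chromatic_number n) / (real n * ln (real n))) \<longlonglongrightarrow> 1"
proof (rule tendsto_sandwich)
  show "(\<lambda>n. (real n + 1) * (ln (real n / 2 + 1) - 1) / (real n * ln (real n))) \<longlonglongrightarrow> 1"
    by real_asymp
  show "(\<lambda>n. real n * (ln (real n + 1) + 1) / (real n * ln (real n))) \<longlonglongrightarrow> 1"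
    by real_asymp
  show "\<forall>\<^sub>F n in sequentially. (real n + 1) * (ln (real n / 2 + 1) - 1) / (real n * ln (real n))
      \<le> real (cyclohedron_chromatic_number n) / (real n * ln (real n))"
    using eventually_gt_at_top[of 1]
    by eventually_elim (intro divide_right_mono cyclohedron_chromatic_number_lower, auto)
  show "\<forall>\<^sub>F n in sequentially. real (cyclohedron_chromatic_number n) / (real n * ln (real n))
      \<le> real n * (ln (real n + 1) + 1) / (real n * ln (real n))"
    using eventually_gt_at_top[of 1]
    by eventually_elim (intro divide_right_mono cyclohedron_chromatic_number_upper, auto)
qed

end
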